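(* Let $n$ and $r$ be positive integers with $n\geq 3.5r+1$, and let $\mathcal{F}\subset 2^{[n]}$ be a $2r$-union family. Then $$|\mathcal{F}^{(\geq r)}|\leq \binom{n}{r},$$ with equality if and only if $\mathcal{F}^{(\geq r)}=\binom{[n]}{r}$.
   Context: $[n]=\{1,2,\ldots,n\}$, $2^{[n]}$ is its power set, and $\binom{[n]}{k}$ is the family of all $k$-element subsets of $[n]$. For a positive integer $u$, a family $\mathcal{F}\subset 2^{[n]}$ is called $u$-union if $|F\cup F'|\leq u$ for all $F,F'\in\mathcal{F}$ (including $F=F'$). For an integer $\ell$, $\mathcal{F}^{(\geq \ell)}=\{F\in\mathcal{F}\colon |F|\geq \ell\}$. *)

theory Defs
  imports Complex_Main
begin

(* Intended for families of finite sets only: card is 0 on infinite sets. *)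

definition union_family :: "nat \<Rightarrow> 'a set set \<Rightarrow> bool" where
  "union_family u \<F> \<longleftrightarrow> (\<forall>F\<in>\<F>. \<forall>F'\<in>\<F>. card (F \<union> F') \<le> u)"

definition size_at_least :: "nat \<Rightarrow> 'a set set \<Rightarrow> 'a set set" where
  "size_at_least l \<F> = {F \<in> \<F>. card F \<ge> l}"

definition k_subsets :: "'a set \<Rightarrow> nat \<Rightarrow> 'a set set" where
  "k_subsets X k = {F. F \<subseteq> X \<and> card F = k}"

end

(* The complements of the members of size at least r form a q-intersecting family of sets of size
   at most q + r, where q = n - 2r, and left-shifting changes neither this nor the sizes. Read a set
   as a walk that steps up at its elements. In the shifted family any two walks have, at some common
   time, heights with sum at least 2q; in particular every walk reaches height q. The members of
   size q + r end exactly at q. Suppose that some member is smaller, that is, ends below q. Let h be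
   maximal such that all smaller members reach q + h.
   If h > 0, or if all smaller members reach q at least twice, then reflection bounds their
   number by fewer than the sets of size q + r excluded by a member that does not exceed q + h.
   Otherwise some smaller member reaches q at a single time tau. Then every member not exceeding q
   is at height q at time tau, and these together with all walks exceeding q are still fewer than
   n choose r. *)

theory Submission
  imports Defs
begin

section \<open>Shifting\<close>

definition intersecting :: "nat \<Rightarrow> nat set set \<Rightarrow> bool" where
  "intersecting q \<H> \<longleftrightarrow> (\<forall>A\<in>\<H>. \<forall>B\<in>\<H>. q \<le> card (A \<inter> B))"

definition left_shifted :: "nat set set \<Rightarrow> bool" where
  "left_shifted \<H> \<longleftrightarrow> (\<forall>A\<in>\<H>. \<forall>i j. 0 < i \<longrightarrow> i < j \<longrightarrow> j \<in> A \<longrightarrow> i \<notin> A \<longrightarrow> insert i (A - {j}) \<in> \<H>)"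

text \<open>A set whose image is already present stays put; this keeps the map injective on the
  family.\<close>

definition shift :: "nat \<Rightarrow> nat \<Rightarrow> nat set set \<Rightarrow> nat set \<Rightarrow> nat set" where
  "shift i j \<H> A = (if j \<in> A \<and> i \<notin> A \<and> insert i (A - {j}) \<notin> \<H> then insert i (A - {j}) else A)"

lemma card_replace:
  assumes "finite A" "j \<in> A" "i \<notin> A"
  shows "card (insert i (A - {j})) = card A"
  using assms by (metis DiffE card_Suc_Diff1 card_insert_disjoint finite_Diff)

lemma card_shift: "finite A \<Longrightarrow> card (shift i j \<H> A) = card A"
  using card_replace[of A j i] by (simp add: shift_def del: card_insert_disjoint)

text \<open>A moved set lands outside the family, so it differs from every fixed one, and two moved
  sets are recovered by undoing the replacement.\<close>

lemma inj_on_shift: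
  assumes "i \<noteq> j"
  shows "inj_on (shift i j \<H>) \<H>"
proof (rule inj_onI)
  fix A B assume AB: "A \<in> \<H>" "B \<in> \<H>" "shift i j \<H> A = shift i j \<H> B"
  have recover: "C = insert j (insert i (C - {j}) - {i})" if "j \<in> C" "i \<notin> C" for C
    using that assms by auto
  show "A = B"
    using AB recover[of A] recover[of B] unfolding shift_def by (metis (full_types))
qed

lemma intersecting_shift:
  assumes fin: "\<And>A. A \<in> \<H> \<Longrightarrow> finite A" and int: "intersecting q \<H>" and "i \<noteq> j"
  shows "intersecting q (shift i j \<H> ` \<H>)"
proof -
  have int': "q \<le> card (A \<inter> B)" if "A \<in> \<H>" "B \<in> \<H>" for A B
    using int that by (auto simp: intersecting_def)
  have mixed: "q \<le> card (insert i (A - {j}) \<inter> B)"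
    if A: "A \<in> \<H>" "j \<in> A" "i \<notin> A" "insert i (A - {j}) \<notin> \<H>"
      and B: "B \<in> \<H>" "\<not> (j \<in> B \<and> i \<notin> B \<and> insert i (B - {j}) \<notin> \<H>)" for A B
  proof -
    have fA: "finite A" "finite B" using fin A B by auto
    consider "j \<notin> B" | "j \<in> B" "i \<in> B" | "j \<in> B" "i \<notin> B" "insert i (B - {j}) \<in> \<H>"
      using B by blast
    then show ?thesis
    proof cases
      case 1
      then have "A \<inter> B \<subseteq> insert i (A - {j}) \<inter> B" by auto
      then show ?thesis using int'[OF A(1) B(1)] card_mono fA
        by (meson finite_Int le_trans)
    next
      case 2
      have "insert i (A - {j}) \<inter> B = insert i ((A \<inter> B) - {j})" using 2 by auto
      then show ?thesis using int'[OF A(1) B(1)] card_replace[of "A \<inter> B" j i] 2 A fA by auto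
    next
      case 3
      \<comment> \<open>\<open>B\<close> stays put only because its own image is present, so the
        hypothesis applies to \<open>A\<close> and that image, which have the same
        intersection.\<close>
      have "insert i (A - {j}) \<inter> B = A \<inter> insert i (B - {j})" using 3 A by auto
      then show ?thesis using int'[OF A(1) 3(3)] by simp
    qed
  qed
  have both: "q \<le> card (insert i (A - {j}) \<inter> insert i (B - {j}))"
    if A: "A \<in> \<H>" "j \<in> A" "i \<notin> A" and B: "B \<in> \<H>" "j \<in> B" "i \<notin> B" for A B
  proof -
    have "insert i (A - {j}) \<inter> insert i (B - {j}) = insert i ((A \<inter> B) - {j})" by auto
    then show ?thesis using int'[OF A(1) B(1)] card_replace[of "A \<inter> B" j i] fin A B by auto
  qed
  show ?thesis
    unfolding intersecting_def
  proof (intro ballI)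
    fix X Y assume "X \<in> shift i j \<H> ` \<H>" "Y \<in> shift i j \<H> ` \<H>"
    then obtain A B where AB: "A \<in> \<H>" "B \<in> \<H>" "X = shift i j \<H> A" "Y = shift i j \<H> B" by auto
    show "q \<le> card (X \<inter> Y)"
      using AB mixed[of A B] mixed[of B A] both[of A B] int'[of A B]
      by (simp add: shift_def Int_commute)
  qed
qed

text \<open>A shift that moves some set strictly lowers the total of all elements of all members, so
  shifting terminates. Each shift is injective and keeps sizes, hence the number of members of each
  size survives.\<close>

lemma exists_left_shifted:
  assumes "\<H> \<subseteq> Pow {1..n}" "intersecting q \<H>"
  shows "\<exists>\<G>. \<G> \<subseteq> Pow {1..n} \<and> intersecting q \<G> \<and> left_shifted \<G>
    \<and> (\<forall>P. card {A \<in> \<G>. P (card A)} = card {A \<in> \<H>. P (card A)})"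
  using assms
proof (induction "\<Sum>A\<in>\<H>. \<Sum>A" arbitrary: \<H> rule: less_induct)
  case less
  have finH: "finite \<H>" using less.prems(1) finite_subset by blast
  have fin: "finite A" if "A \<in> \<H>" for A using less.prems(1) that finite_subset by blast
  show ?case
  proof (cases "left_shifted \<H>")
    case True then show ?thesis using less.prems by blast
  next
    case False
    then obtain A i j where ij: "A \<in> \<H>" "0 < i" "i < j" "j \<in> A" "i \<notin> A" "insert i (A - {j}) \<notin> \<H>"
      by (auto simp: left_shifted_def)
    define s where "s = shift i j \<H>"
    have inj: "inj_on s \<H>" using inj_on_shift ij by (simp add: s_def)
    have le: "\<Sum>(insert i (B - {j})) < \<Sum>B" if "B \<in> \<H>" "j \<in> B" "i \<notin> B" for B
    proof -
      have "\<Sum>B = j + \<Sum>(B - {j})" using that fin by (simp add: sum.remove)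
      moreover have "\<Sum>(insert i (B - {j})) = i + \<Sum>(B - {j})" using that fin by simp
      ultimately show ?thesis using ij by simp
    qed
    have "(\<Sum>A\<in>\<H>. \<Sum>(s A)) < (\<Sum>A\<in>\<H>. \<Sum>A)"
    proof (rule sum_strict_mono_ex1[OF finH])
      show "\<forall>x\<in>\<H>. \<Sum>(s x) \<le> \<Sum>x" using le by (auto simp: s_def shift_def less_imp_le)
      show "\<exists>a\<in>\<H>. \<Sum>(s a) < \<Sum>a" using le ij by (auto simp: s_def shift_def)
    qed
    moreover have "(\<Sum>A\<in>s ` \<H>. \<Sum>A) = (\<Sum>A\<in>\<H>. \<Sum>(s A))"
      using inj by (simp add: sum.reindex)
    ultimately have lt: "(\<Sum>A\<in>s ` \<H>. \<Sum>A) < (\<Sum>A\<in>\<H>. \<Sum>A)" by simp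
    have "j \<in> {1..n}" using ij(1,4) less.prems(1) by blast
    then have sub: "s ` \<H> \<subseteq> Pow {1..n}" using less.prems(1) ij
      by (auto simp: s_def shift_def split: if_splits)
    have int: "intersecting q (s ` \<H>)"
      using intersecting_shift[OF fin less.prems(2)] ij by (simp add: s_def)
    have "card {A \<in> s ` \<H>. P (card A)} = card {A \<in> \<H>. P (card A)}" for P
    proof -
      have "{A \<in> s ` \<H>. P (card A)} = s ` {A \<in> \<H>. P (card A)}"
      proof (intro equalityI subsetI)
        fix B assume "B \<in> {A \<in> s ` \<H>. P (card A)}"
        then obtain A where "A \<in> \<H>" "B = s A" "P (card B)" by auto
        then show "B \<in> s ` {A \<in> \<H>. P (card A)}"
          using card_shift[OF fin, of A i j \<H>] by (auto simp: s_def)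
      next
        fix B assume "B \<in> s ` {A \<in> \<H>. P (card A)}"
        then obtain A where "A \<in> \<H>" "B = s A" "P (card A)" by auto
        then show "B \<in> {A \<in> s ` \<H>. P (card A)}"
          using card_shift[OF fin, of A i j \<H>] by (auto simp: s_def)
      qed
      moreover have "inj_on s {A \<in> \<H>. P (card A)}" using inj by (rule inj_on_subset) auto
      ultimately show ?thesis by (simp add: card_image)
    qed
    moreover obtain \<G> where "\<G> \<subseteq> Pow {1..n}" "intersecting q \<G>" "left_shifted \<G>"
      "\<forall>P. card {A \<in> \<G>. P (card A)} = card {A \<in> s ` \<H>. P (card A)}"
      using less.hyps[OF lt sub int] by blast
    ultimately show ?thesis by (intro exI[of _ \<G>]) simp
  qed
qed

text \<open>If a prefix \<open>{1..t}\<close> contains \<open>q\<close> common elements and is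
  covered by \<open>A \<union> B\<close>, inclusion-exclusion gives the claim. If it has a gap,
  shifting a common element of \<open>B\<close> into the gap shrinks the intersection with
  \<open>A\<close>, so induction on its size applies.\<close>

lemma left_shifted_prefix:
  assumes sub: "\<H> \<subseteq> Pow {1..n}" and int: "intersecting q \<H>" and ls: "left_shifted \<H>"
    and "A \<in> \<H>" "B \<in> \<H>"
  shows "\<exists>t\<le>n. t + q \<le> card (A \<inter> {1..t}) + card (B \<inter> {1..t})"
  using \<open>B \<in> \<H>\<close>
proof (induction "card (A \<inter> B)" arbitrary: B rule: less_induct)
  case less
  have sA: "A \<subseteq> {1..n}" and sB: "B \<subseteq> {1..n}" using assms less.prems by auto
  have fA: "finite A" "finite B" using sA sB finite_subset by blast+
  define c where "c t = card (A \<inter> B \<inter> {1..t})" for t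
  have un: "card (A \<inter> {1..t}) + card (B \<inter> {1..t}) = card ((A \<union> B) \<inter> {1..t}) + c t" for t
    using card_Un_Int[of "A \<inter> {1..t}" "B \<inter> {1..t}"]
    by (simp add: c_def Int_Un_distrib2 Int_ac)
  have cn: "q \<le> c n"
  proof -
    have "A \<inter> B \<inter> {1..n} = A \<inter> B" using sA by auto
    then show ?thesis using int assms less.prems by (auto simp: c_def intersecting_def)
  qed
  \<comment> \<open>The first time with \<open>q\<close> common elements: \<open>t\<close> itself is
    then common, and every earlier prefix has fewer than \<open>q\<close>.\<close>
  define t where "t = (LEAST t. q \<le> c t)"
  have ct: "q \<le> c t" unfolding t_def using cn by (rule LeastI)
  have tn: "t \<le> n" unfolding t_def using cn by (rule Least_le)
  have cl: "c s < q" if "s < t" for s using not_less_Least that unfolding t_def by (metis not_le)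
  show ?case
  proof (cases "{1..t} \<subseteq> A \<union> B")
    case True
    then have "(A \<union> B) \<inter> {1..t} = {1..t}" by auto
    then show ?thesis using un[of t] ct tn by (intro exI[of _ t]) simp
  next
    case False
    then obtain j where "j \<in> {1..t}" and jAB: "j \<notin> A" "j \<notin> B" by blast
    then have j: "1 \<le> j" "j \<le> t" "j \<notin> A" "j \<notin> B" by auto
    have tAB: "t \<in> A \<inter> B"
    proof (rule ccontr)
      assume "t \<notin> A \<inter> B"
      then have "x \<le> t - 1" if "x \<in> A \<inter> B" "x \<le> t" for x using that by (cases "x = t") auto
      then have "A \<inter> B \<inter> {1..t} = A \<inter> B \<inter> {1..t-1}" by (auto intro: le_trans)
      then show False using cl[of "t-1"] ct j by (simp add: c_def)
    qed
    then have jt: "j < t" using j by (metis IntD1 le_neq_implies_less)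
    define B' where "B' = insert j (B - {t})"
    have B': "B' \<in> \<H>" unfolding B'_def using ls less.prems tAB j jt by (auto simp: left_shifted_def)
    have "A \<inter> B' \<subset> A \<inter> B" using tAB j by (auto simp: B'_def)
    then have "card (A \<inter> B') < card (A \<inter> B)" using fA by (simp add: psubset_card_mono)
    from less.hyps[OF this B'] obtain s where s: "s \<le> n"
      "s + q \<le> card (A \<inter> {1..s}) + card (B' \<inter> {1..s})" by blast
    show ?thesis
    proof (cases "j \<le> s \<and> s < t")
      case True
      \<comment> \<open>Only for these \<open>s\<close> does \<open>B'\<close> gain on
        \<open>B\<close>. But then \<open>A \<union> B\<close> misses \<open>j\<close> and there are
        fewer than \<open>q\<close> common elements, so even with the extra element the sum stays
        below \<open>s + q\<close>.\<close>
      have "B' \<inter> {1..s} = insert j (B \<inter> {1..s})" using True j by (auto simp: B'_def)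
      then have 1: "card (B' \<inter> {1..s}) = Suc (card (B \<inter> {1..s}))" using j by simp
      have "(A \<union> B) \<inter> {1..s} \<subseteq> {1..s} - {j}" using j by auto
      then have "card ((A \<union> B) \<inter> {1..s}) \<le> card ({1..s} - {j})" by (intro card_mono) auto
      also have "\<dots> = s - 1" using True j by simp
      finally show ?thesis using 1 un[of s] cl[of s] s True j by linarith
    next
      case False
      have "card (B' \<inter> {1..s}) \<le> card (B \<inter> {1..s})"
      proof (cases "s < j")
        case True
        then show ?thesis using fA by (intro card_mono) (auto simp: B'_def)
      next
        case F: False
        have "B' \<inter> {1..s} = insert j (B \<inter> {1..s} - {t})" using F False j jt by (auto simp: B'_def)
        then show ?thesis using card_replace[of "B \<inter> {1..s}" t j] F False tAB j fA by simp
      qed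
      then show ?thesis using s by (meson add_left_mono le_trans)
    qed
  qed
qed

section \<open>Counting lattice walks\<close>

text \<open>A set is read as a walk stepping up at its elements and down elsewhere; its height at time
  \<open>t\<close> is \<open>2 * card (A \<inter> {1..t}) - t\<close>, so \<open>hits n m A\<close> are the times with height at least \<open>m\<close>.\<close>

definition hits :: "nat \<Rightarrow> nat \<Rightarrow> nat set \<Rightarrow> nat set" where
  "hits n m A = {t. t \<le> n \<and> t + m \<le> 2 * card (A \<inter> {1..t})}"

text \<open>The predicate on the set of hits lets one recursion serve both for walks that reach the
  height and for walks that reach it twice.\<close>

definition walks :: "nat \<Rightarrow> nat \<Rightarrow> nat \<Rightarrow> (nat set \<Rightarrow> bool) \<Rightarrow> nat set set" where
  "walks n k m P = {A. A \<subseteq> {1..n} \<and> card A = k \<and> P (hits n m A)}"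

lemma finite_walks [simp]: "finite (walks n k m P)"
  by (rule finite_subset[of _ "Pow {1..n}"]) (auto simp: walks_def)

lemma finite_subsets [simp]: "finite {A. A \<subseteq> {1..n::nat} \<and> Q A}"
  by (rule finite_subset[of _ "Pow {1..n}"]) auto

lemma card_subsets: "card {A. A \<subseteq> {1..n::nat} \<and> card A = k} = n choose k"
  using n_subsets[of "{1..n}" k] by simp

lemma finite_hits [simp]: "finite (hits n m A)"
  by (rule finite_subset[of _ "{..n}"]) (auto simp: hits_def)

lemma hits_ge: "t \<in> hits n m A \<Longrightarrow> m \<le> t"
  using card_mono[of "{1..t}" "A \<inter> {1..t}"] by (auto simp: hits_def)

lemma hits_card: "t \<in> hits n m A \<Longrightarrow> finite A \<Longrightarrow> m \<le> card A \<and> t \<le> 2 * card A - m"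
  using card_mono[of A "A \<inter> {1..t}"] hits_ge[of t n m A] by (auto simp: hits_def)

text \<open>A step raises the height by at most one.\<close>

lemma hits_Suc_level:
  assumes "t \<in> hits n (Suc m) A"
  shows "t - 1 \<in> hits n m A" "t - 1 < t"
proof -
  have t: "t \<ge> Suc m" using hits_ge assms by blast
  then obtain s where s: "t = Suc s" by (cases t) auto
  have "card (A \<inter> {1..Suc s}) \<le> Suc (card (A \<inter> {1..s}))"
  proof -
    have "A \<inter> {1..Suc s} \<subseteq> insert (Suc s) (A \<inter> {1..s})" by (auto simp: le_Suc_eq)
    then have "card (A \<inter> {1..Suc s}) \<le> card (insert (Suc s) (A \<inter> {1..s}))"
      by (intro card_mono) auto
    then show ?thesis by simp
  qed
  then show "t - 1 \<in> hits n m A" "t - 1 < t"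
    using assms s by (auto simp: hits_def)
qed

section \<open>Recursion on the last step and the reflection principle\<close>

text \<open>The second hypothesis says that the walk ends below height \<open>m\<close>, so its last
  step decides nothing.\<close>

lemma hits_Suc:
  assumes "A \<subseteq> {1..Suc n}" "2 * card A < Suc n + m"
  shows "hits (Suc n) m A = hits n m (A - {Suc n})"
proof -
  have "A \<inter> {1..Suc n} = A" using assms by auto
  then have "Suc n \<notin> hits (Suc n) m A" using assms by (simp add: hits_def)
  moreover have "(A - {Suc n}) \<inter> {1..t} = A \<inter> {1..t}" if "t \<le> n" for t using that by auto
  ultimately show ?thesis by (auto simp: hits_def le_Suc_eq)
qed

lemma card_split_last:
  assumes R: "\<And>A. A \<subseteq> {1..n} \<Longrightarrow> R (insert (Suc n) A) = R' A"
  shows "card {A. A \<subseteq> {1..Suc n} \<and> card A = Suc k \<and> R A}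
    = card {A. A \<subseteq> {1..n} \<and> card A = Suc k \<and> R A} + card {A. A \<subseteq> {1..n} \<and> card A = k \<and> R' A}"
    (is "card ?L = card ?X + card ?Y")
proof -
  have n: "Suc n \<notin> A" if "A \<subseteq> {1..n}" for A using that by auto
  have fin: "finite A" if "A \<subseteq> {1..n}" for A using that finite_subset by blast
  have L: "?L = ?X \<union> insert (Suc n) ` ?Y"
  proof (intro equalityI subsetI)
    fix A assume A: "A \<in> ?L"
    show "A \<in> ?X \<union> insert (Suc n) ` ?Y"
    proof (cases "Suc n \<in> A")
      case True
      define B where "B = A - {Suc n}"
      have B: "B \<subseteq> {1..n}" "A = insert (Suc n) B" using A True by (auto simp: B_def le_Suc_eq)
      then show ?thesis using A R[OF B(1)] n[OF B(1)] fin[OF B(1)] by auto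
    next
      case False
      then have "A \<subseteq> {1..n}" using A by (auto simp: le_Suc_eq)
      then show ?thesis using A by simp
    qed
  next
    fix A assume "A \<in> ?X \<union> insert (Suc n) ` ?Y"
    then show "A \<in> ?L"
    proof
      assume "A \<in> insert (Suc n) ` ?Y"
      then obtain B where B: "A = insert (Suc n) B" "B \<in> ?Y" by auto
      then show ?thesis using R[of B] n[of B] fin[of B] by auto
    qed auto
  qed
  have "finite ?X" "finite ?Y" by (rule finite_subset[of _ "Pow {1..n}"], auto)+
  moreover have "?X \<inter> insert (Suc n) ` ?Y = {}" using n by auto
  moreover have "card (insert (Suc n) ` ?Y) = card ?Y"
  proof (rule card_image, rule inj_onI)
    fix A B assume "A \<in> ?Y" "B \<in> ?Y" "insert (Suc n) A = insert (Suc n) B"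
    then show "A = B" using n[of A] n[of B] by (metis (no_types, lifting) insert_ident mem_Collect_eq)
  qed
  ultimately show ?thesis unfolding L by (simp add: card_Un_disjoint)
qed

lemma hits_insert: "A \<subseteq> {1..n} \<Longrightarrow> hits n m (insert (Suc n) A) = hits n m A"
proof -
  have "insert (Suc n) A \<inter> {1..t} = A \<inter> {1..t}" if "t \<le> n" for t using that by auto
  then show ?thesis by (auto simp: hits_def)
qed

text \<open>Pascal's rule according to the last step; the hypothesis puts the endpoint below height
  \<open>m\<close>.\<close>

lemma card_walks_Suc:
  assumes "2 * Suc k < Suc n + m"
  shows "card (walks (Suc n) (Suc k) m P) = card (walks n (Suc k) m P) + card (walks n k m P)"
proof -
  have "walks (Suc n) (Suc k) m P = {A. A \<subseteq> {1..Suc n} \<and> card A = Suc k \<and> P (hits n m A)}"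
  proof -
    have "hits n m (A - {Suc n}) = hits n m A" for A
    proof -
      have "(A - {Suc n}) \<inter> {1..t} = A \<inter> {1..t}" if "t \<le> n" for t using that by auto
      then show ?thesis by (auto simp: hits_def)
    qed
    then show ?thesis using hits_Suc[of _ n m] assms by (auto simp: walks_def)
  qed
  then show ?thesis using card_split_last[of n "\<lambda>A. P (hits n m A)" "\<lambda>A. P (hits n m A)" k]
    by (simp add: hits_insert walks_def)
qed

text \<open>The reflection principle: \<open>n choose j\<close> counts the walks ending at the mirror image of the
  endpoint in the line of height \<open>m\<close>.\<close>

lemma card_walks_reaching:
  assumes "0 < m" "m + 2 * j \<le> n"
  shows "card (walks n (m + j) m (\<lambda>T. T \<noteq> {})) = n choose j"
  using assms(2)
proof (induction n arbitrary: j)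
  case 0
  then show ?case using assms by simp
next
  case (Suc n)
  show ?case
  proof (cases "Suc n = m + 2 * j")
    case True
    \<comment> \<open>The endpoint lies on the line, so every walk of this size reaches it.\<close>
    have "Suc n \<in> hits (Suc n) m A" if "A \<subseteq> {1..Suc n}" "card A = m + j" for A
    proof -
      have "A \<inter> {1..Suc n} = A" using that by auto
      then show ?thesis using True that by (simp add: hits_def)
    qed
    then have "walks (Suc n) (m + j) m (\<lambda>T. T \<noteq> {}) = {A. A \<subseteq> {1..Suc n} \<and> card A = m + j}"
      by (auto simp: walks_def)
    then have "card (walks (Suc n) (m + j) m (\<lambda>T. T \<noteq> {})) = Suc n choose (m + j)"
      by (simp only: card_subsets)
    also have "\<dots> = Suc n choose j" using True binomial_symmetric[of j "Suc n"] by (simp add: add.commute)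
    finally show ?thesis .
  next
    case False
    then have le: "m + 2 * j \<le> n" using Suc.prems by simp
    obtain k where k: "m + j = Suc k" using assms by (cases "m + j") auto
    have "card (walks (Suc n) (m + j) m (\<lambda>T. T \<noteq> {}))
      = (n choose j) + card (walks n k m (\<lambda>T. T \<noteq> {}))"
      using card_walks_Suc[of k n m] Suc.IH[OF le] le k by simp
    also have "\<dots> = Suc n choose j"
    proof (cases j)
      case 0
      \<comment> \<open>Here \<open>k = m - 1\<close> up steps are too few to reach height
        \<open>m\<close>.\<close>
      have "hits n m A = {}" if "A \<subseteq> {1..n}" "card A = k" for A
        using hits_card[of _ n m A] finite_subset[OF that(1)] that k 0 by fastforce
      then have "walks n k m (\<lambda>T. T \<noteq> {}) = {}" by (auto simp: walks_def)
      then show ?thesis using 0 by simp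
    next
      case (Suc i)
      then have "k = m + i" using k by simp
      then show ?thesis using Suc.IH[of i] le Suc by simp
    qed
    finally show ?thesis .
  qed
qed

text \<open>The bound obeys Pascal's rule, so it suffices to check \<open>j = 0\<close> and
  endpoints on the line. In the latter case the endpoint is one hit and a second one is needed
  earlier.\<close>

lemma card_walks_twice:
  assumes "0 < m" "m + 2 * j \<le> n"
  shows "card (walks n (m + j) m (\<lambda>T. 2 \<le> card T)) \<le> (if j = 0 then 0 else 2 * ((n - 1) choose (j - 1)))"
  using assms(2)
proof (induction n arbitrary: j)
  case 0
  then show ?case using assms by simp
next
  case (Suc n)
  obtain k where k: "m + j = Suc k" using assms by (cases "m + j") auto
  show ?case
  proof (cases j)
    case 0
    have "\<not> 2 \<le> card (hits (Suc n) m A)" if "A \<subseteq> {1..Suc n}" "card A = m" for A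
    proof -
      \<comment> \<open>With only \<open>m\<close> up steps, height \<open>m\<close> is reached at
        most at time \<open>m\<close>, after going up all the time.\<close>
      have "hits (Suc n) m A \<subseteq> {m}"
        using hits_card[of _ "Suc n" m A] hits_ge[of _ "Suc n" m A] finite_subset[OF that(1)] that by fastforce
      then have "card (hits (Suc n) m A) \<le> card {m}" by (intro card_mono) auto
      then show ?thesis by simp
    qed
    then have "walks (Suc n) (m + j) m (\<lambda>T. 2 \<le> card T) = {}" using 0 by (auto simp: walks_def simp del: One_nat_def)
    then show ?thesis by simp
  next
    case (Suc i)
    have ki: "k = m + i" using k Suc by simp
    show ?thesis
    proof (cases "Suc n = m + 2 * j")
      case True
      let ?R = "\<lambda>A. hits n m A \<noteq> {}"
      have "walks (Suc n) (m + j) m (\<lambda>T. 2 \<le> card T) \<subseteq> {A. A \<subseteq> {1..Suc n} \<and> card A = Suc k \<and> ?R A}"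
      proof
        fix A assume A: "A \<in> walks (Suc n) (m + j) m (\<lambda>T. 2 \<le> card T)"
        have "\<not> hits (Suc n) m A \<subseteq> {Suc n}"
        proof
          assume "hits (Suc n) m A \<subseteq> {Suc n}"
          then have "card (hits (Suc n) m A) \<le> card {Suc n}" by (intro card_mono) auto
          then show False using A by (simp add: walks_def)
        qed
        then obtain t where "t \<in> hits (Suc n) m A" "t \<noteq> Suc n" by blast
        then have "t \<in> hits n m A" by (simp add: hits_def)
        then have "?R A" by blast
        then show "A \<in> {A. A \<subseteq> {1..Suc n} \<and> card A = Suc k \<and> ?R A}" using A k by (auto simp: walks_def)
      qed
      then have "card (walks (Suc n) (m + j) m (\<lambda>T. 2 \<le> card T))
        \<le> card {A. A \<subseteq> {1..Suc n} \<and> card A = Suc k \<and> ?R A}"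
        by (intro card_mono finite_subsets)
      also have "\<dots> = card (walks n (Suc k) m (\<lambda>T. T \<noteq> {})) + card (walks n k m (\<lambda>T. T \<noteq> {}))"
        using card_split_last[of n ?R ?R k] by (simp add: hits_insert walks_def)
      \<comment> \<open>If the last step goes down, time \<open>n\<close> is at height
        \<open>m + 1\<close> and all walks count; if it goes up, time \<open>n\<close> is at height
        \<open>m - 1\<close> and reflection applies. Each kind contributes at most
        \<open>n choose i\<close>.\<close>
      also have "card (walks n (Suc k) m (\<lambda>T. T \<noteq> {})) \<le> card {A. A \<subseteq> {1..n} \<and> card A = Suc k}"
        by (intro card_mono finite_subsets) (auto simp: walks_def)
      also have "\<dots> = n choose i"
      proof -
        have "n - i = Suc k" "i \<le> n" using True Suc k by auto
        then show ?thesis using binomial_symmetric[of i n] card_subsets[of n "Suc k"] by simp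
      qed
      also have "card (walks n k m (\<lambda>T. T \<noteq> {})) = n choose i"
        unfolding ki using True Suc assms by (intro card_walks_reaching) auto
      finally show ?thesis using Suc by simp
    next
      case False
      then have le: "m + 2 * j \<le> n" using Suc.prems by simp
      then obtain n' where n': "n = Suc n'" using Suc by (cases n) auto
      have "card (walks (Suc n) (m + j) m (\<lambda>T. 2 \<le> card T))
        = card (walks n (m + j) m (\<lambda>T. 2 \<le> card T)) + card (walks n (m + i) m (\<lambda>T. 2 \<le> card T))"
        using card_walks_Suc[of k n m] le k ki by simp
      also have "\<dots> \<le> 2 * ((n - 1) choose i) + (if i = 0 then 0 else 2 * ((n - 1) choose (i - 1)))"
        using Suc.IH[of j] Suc.IH[of i] le Suc by simp
      also have "\<dots> = 2 * (n choose i)" by (cases i) (auto simp: n')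
      finally show ?thesis using Suc by simp
    qed
  qed
qed

lemma card_nonreaching:
  assumes "0 < m" "m + 2 * j \<le> n"
  shows "card (walks n (m + j) m (\<lambda>T. T = {})) + (n choose j) = n choose (m + j)"
proof -
  have "{A. A \<subseteq> {1..n} \<and> card A = m + j} = walks n (m + j) m (\<lambda>T. T = {}) \<union> walks n (m + j) m (\<lambda>T. T \<noteq> {})"
    by (auto simp: walks_def)
  then have "n choose (m + j) = card (walks n (m + j) m (\<lambda>T. T = {}) \<union> walks n (m + j) m (\<lambda>T. T \<noteq> {}))"
    using card_subsets[of n "m + j"] by simp
  also have "\<dots> = card (walks n (m + j) m (\<lambda>T. T = {})) + card (walks n (m + j) m (\<lambda>T. T \<noteq> {}))"
    by (intro card_Un_disjoint) (auto simp: walks_def)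
  finally show ?thesis using card_walks_reaching[OF assms] by simp
qed

lemma card_small_walks:
  assumes bound: "\<And>j. j < p \<Longrightarrow> card (walks n (m + j) m' P) \<le> f j"
  shows "card {A. A \<subseteq> {1..n} \<and> m \<le> card A \<and> card A < m + p \<and> P (hits n m' A)} \<le> (\<Sum>j<p. f j)"
proof -
  have "{A. A \<subseteq> {1..n} \<and> m \<le> card A \<and> card A < m + p \<and> P (hits n m' A)} = (\<Union>j<p. walks n (m + j) m' P)"
      (is "?L = ?R")
  proof (intro equalityI subsetI)
    fix A assume "A \<in> ?L"
    moreover from this have "card A - m < p" "card A = m + (card A - m)" by auto
    ultimately show "A \<in> ?R" by (auto simp: walks_def)
  qed (auto simp: walks_def)
  then have "card {A. A \<subseteq> {1..n} \<and> m \<le> card A \<and> card A < m + p \<and> P (hits n m' A)}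
    \<le> (\<Sum>j<p. card (walks n (m + j) m' P))" using card_UN_le[of "{..<p}"] by simp
  also have "\<dots> \<le> (\<Sum>j<p. f j)" using bound by (intro sum_mono) auto
  finally show ?thesis .
qed

section \<open>Binomial inequalities\<close>

text \<open>Subtraction is in the reals, so the identity also covers \<open>k \<ge> n\<close>, where
  both sides vanish.\<close>

lemma Suc_times_choose_Suc: "real (Suc k) * real (n choose Suc k) = (real n - real k) * real (n choose k)"
proof -
  have "real (Suc n * (n choose k)) = real ((Suc n choose Suc k) * Suc k)"
    by (simp only: Suc_times_binomial_eq)
  then show ?thesis by (simp add: algebra_simps)
qed

lemma Suc_minus_times_Suc_choose: "(real n + 1 - real k) * real (Suc n choose k) = (real n + 1) * real (n choose k)"
proof (cases k)
  case 0 then show ?thesis by simp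
next
  case (Suc i)
  then show ?thesis using Suc_times_choose_Suc[of i n] by (simp add: algebra_simps)
qed

text \<open>A geometric series with denominators cleared: below \<open>k\<close> consecutive ratios
  are at most \<open>k / (n - k + 1)\<close>, and ratio \<open>x\<close> gives the factor
  \<open>x / (1 - x) = k / (n - 2 * k + 1)\<close>.\<close>

lemma sum_choose_le:
  "2 * k \<le> n \<Longrightarrow> (\<Sum>i<k. real (n choose i)) * (real n - 2 * real k + 1) \<le> real (n choose k) * real k"
proof (induction k)
  case 0 then show ?case by simp
next
  case (Suc k)
  define S c y where "S = (\<Sum>i<k. real (n choose i))" and "c = real (n choose k)"
    and "y = real n - 2 * real k + 1"
  have y: "y \<ge> 3" using of_nat_mono[OF Suc.prems, where 'a = real] by (simp add: y_def)
  have c: "c \<ge> 0" by (simp add: c_def)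
  have IH: "S * y \<le> c * k" using Suc by (simp add: S_def c_def y_def)
  \<comment> \<open>The factor belonging to \<open>Suc k\<close> is \<open>y - 2\<close>;
    multiplying by \<open>y\<close> makes the induction hypothesis applicable.\<close>
  have "(S + c) * (y - 2) * y \<le> (c * (n - real k)) * y"
  proof -
    have "(S + c) * (y - 2) * y = (S * y + c * y) * (y - 2)" by (simp add: algebra_simps)
    also have "\<dots> \<le> (c * k + c * y) * (y - 2)" using IH y by (intro mult_right_mono) auto
    also have "\<dots> = c * (n - real k) * y - c * (n + 1)"
      by (simp add: y_def algebra_simps)
    finally show ?thesis using c by (simp add: algebra_simps) (smt (verit) mult_nonneg_nonneg of_nat_0_le_iff)
  qed
  then have "(S + c) * (y - 2) \<le> c * (n - real k)" using y by simp
  also have "\<dots> = real (n choose Suc k) * Suc k"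
    using Suc_times_choose_Suc[of k n] by (simp add: c_def mult.commute)
  finally show ?case by (simp add: S_def c_def y_def algebra_simps)
qed

text \<open>Here and in the other polynomial inequalities, substituting the slack variables \<open>z\<close> (and
  \<open>u\<close>) leaves a polynomial all of whose coefficients are positive.\<close>

lemma poly_ineq_twice:
  fixes s y :: real
  assumes "s \<ge> 0" "2 * y \<ge> 3 * s + 9"
  shows "2 * (s * (s + 1)) < (y - 2) * y"
proof -
  define z where "z = 2 * y - (3 * s + 9)"
  have y: "y = (3 * s + 9 + z) / 2" and z: "z \<ge> 0" using assms by (auto simp: z_def)
  have "4 * ((y - 2) * y - 2 * (s * (s + 1))) = s^2 + 34 * s + 45 + 6 * s * z + 14 * z + z^2"
    unfolding y by (simp add: field_simps power2_eq_square)
  also have "\<dots> > 0" using assms z by (intro add_nonneg_pos add_pos_nonneg) auto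
  finally show ?thesis by (simp add: mult.commute)
qed

text \<open>For the case in which all smaller members reach height \<open>q\<close> twice: the first
  term bounds their number, and the difference of the other two bounds the excluded large sets from
  below.\<close>

lemma twice_sum_choose_less:
  assumes "0 < r" "7 * r + 2 \<le> 2 * n"
  shows "2 * (\<Sum>i<r-1. (n - 1) choose i) + ((n - 1) choose (r - 1)) < (n - 1) choose r"
proof -
  obtain s N where sN: "r = Suc s" "n = Suc N" using assms by (cases r; cases n) auto
  define S c y where "S = (\<Sum>i<s. real (N choose i))" and "c = real (N choose s)"
    and "y = real N - 2 * real s + 1"
  have N: "2 * N \<ge> 7 * s + 7" using assms sN by simp
  have y: "2 * y \<ge> 3 * real s + 9" using of_nat_mono[OF N, where 'a = real] by (simp add: y_def)
  have c: "c > 0" using N by (simp add: c_def)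
  have Sy: "S * y \<le> c * s" using sum_choose_le[of s N] N by (simp add: S_def c_def y_def)
  have K: "(real s + 1) * real (N choose Suc s) = (real N - s) * c"
    using Suc_times_choose_Suc[of s N] by (simp add: c_def add.commute)
  have "(2 * S * (real s + 1)) * y = (2 * (real s + 1)) * (S * y)" by simp
  also have "\<dots> \<le> (2 * (real s + 1)) * (c * s)" using Sy by (intro mult_left_mono) auto
  also have "\<dots> = c * (2 * (real s * (real s + 1)))" by simp
  also have "\<dots> < c * ((y - 2) * y)"
    using poly_ineq_twice[of s y] y c by (intro mult_strict_left_mono) auto
  finally have "(2 * S * (real s + 1)) * y < (c * (y - 2)) * y" by simp
  then have "2 * S * (real s + 1) < c * (y - 2)" using y by simp
  \<comment> \<open>Since \<open>y - 2 = (N - s) - (s + 1)\<close>, this adds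
    \<open>c * (s + 1)\<close> to both sides.\<close>
  then have "(2 * S + c) * (real s + 1) < (real N - s) * c" by (simp add: y_def algebra_simps)
  then have "(real s + 1) * (2 * S + c) < (real s + 1) * real (N choose Suc s)" using K by (simp add: mult.commute)
  then have "2 * S + c < real (N choose Suc s)" by simp
  then have "real (2 * (\<Sum>i<s. N choose i) + (N choose s)) < real (N choose Suc s)"
    by (simp add: S_def c_def)
  then show ?thesis unfolding of_nat_less_iff by (simp add: sN)
qed

text \<open>The number of walks with \<open>q + R\<close> up steps and \<open>R\<close> down steps that never exceed their final
  height \<open>q\<close>.\<close>

definition ballot :: "nat \<Rightarrow> nat \<Rightarrow> real" where
  "ballot q R = real (q + 2 * R choose R) * (real q + 1) / (real q + real R + 1)"

lemma ballot_Suc: "ballot q (Suc R) = real (q + 2 * Suc R choose Suc R) - real (q + 2 * Suc R choose R)"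
proof -
  have "(real R + 1) * real (q + 2 * Suc R choose Suc R) = (real q + real R + 2) * real (q + 2 * Suc R choose R)"
    using Suc_times_choose_Suc[of R "q + 2 * Suc R"] by (simp add: algebra_simps)
  then have "real (q + 2 * Suc R choose R) = (real R + 1) * real (q + 2 * Suc R choose Suc R) / (real q + real R + 2)"
    by (simp add: field_simps)
  then show ?thesis by (simp add: ballot_def field_simps del: binomial_Suc_Suc)
qed

lemma ballot_0: "ballot q 0 = 1"
  by (simp add: ballot_def)

text \<open>The quotient is
  \<open>(q + 2 * R + 2) * (q + 2 * R + 1) / ((q + R + 2) * (R + 1))\<close>. The constant 4 is the
  number of choices for two free steps, so trading free steps for a longer ballot walk never lowers
  the bound.\<close>

lemma ballot_step:
  assumes "3 * R + 8 \<le> 2 * q"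
  shows "4 * ballot q R \<le> ballot q (Suc R)"
proof -
  define c where "c = real (q + 2 * R choose R)"
  have c1: "(real R + 1) * real (Suc (q + 2 * R) choose Suc R) = (real q + 2 * R + 1) * c"
  proof -
    have "real (Suc R * (Suc (q + 2 * R) choose Suc R)) = real (Suc (q + 2 * R) * (q + 2 * R choose R))"
      by (simp only: Suc_times_binomial)
    then show ?thesis by (simp add: c_def algebra_simps del: binomial_Suc_Suc)
  qed
  have c2: "(real q + R + 1) * real (q + 2 * Suc R choose Suc R) = (real q + 2 * R + 2) * real (Suc (q + 2 * R) choose Suc R)"
    using Suc_minus_times_Suc_choose[of "Suc (q + 2 * R)" "Suc R"] by (simp add: algebra_simps del: binomial_Suc_Suc)
  have "(real R + 1) * ((real q + R + 1) * real (q + 2 * Suc R choose Suc R))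
    = (real q + 2 * R + 2) * ((real q + 2 * R + 1) * c)"
    unfolding c2 c1[symmetric] by simp
  then have K: "real (q + 2 * Suc R choose Suc R)
     = (real q + 2 * R + 2) * (real q + 2 * R + 1) * c / ((real R + 1) * (real q + R + 1))"
    by (simp add: eq_divide_eq mult_ac del: binomial_Suc_Suc)
  define z where "z = 2 * real q - (3 * R + 8)"
  have q: "real q = (3 * R + 8 + z) / 2" and z: "z \<ge> 0" using assms by (auto simp: z_def)
  have "4 * ((real q + 2 * R + 2) * (real q + 2 * R + 1) - 4 * (real q + R + 2) * (real R + 1))
    = 9 * (real R)^2 + 18 * R + 24 + 6 * (R * z) + 14 * z + z^2"
    unfolding q by (simp add: field_simps power2_eq_square)
  also have "\<dots> \<ge> 0" using z by (intro add_nonneg_nonneg) auto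
  finally have poly: "4 * (real q + R + 2) * (real R + 1) \<le> (real q + 2 * R + 2) * (real q + 2 * R + 1)" by simp
  then have poly': "4 * ((real q + R + 2) * (real R + 1)) \<le> (real q + 2 * R + 2) * (real q + 2 * R + 1)"
    by (simp only: mult.assoc)
  define d where "d = c * (real q + 1) / (real q + R + 1)"
  have d: "d \<ge> 0" by (simp add: d_def c_def)
  have "4 * ballot q R = 4 * d" by (simp add: ballot_def d_def c_def)
  also have "\<dots> \<le> (real q + 2 * R + 2) * (real q + 2 * R + 1) / ((real q + R + 2) * (real R + 1)) * d"
    using poly' by (intro mult_right_mono d) (simp add: pos_le_divide_eq)
  also have "\<dots> = ballot q (Suc R)"
    unfolding ballot_def K d_def by (simp add: field_simps)
  finally show ?thesis .
qed

text \<open>For \<open>i > 0\<close> the hypothesis is what \<open>ballot_step\<close> needs at the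
  last step, from \<open>R + i - 1\<close>.\<close>

lemma ballot_power:
  assumes "3 * (R + i) + 5 \<le> 2 * q"
  shows "4 ^ i * ballot q R \<le> ballot q (R + i)"
  using assms
proof (induction i)
  case (Suc i)
  then have "4 ^ Suc i * ballot q R \<le> 4 * ballot q (R + i)" by simp
  also have "\<dots> \<le> ballot q (Suc (R + i))" using Suc.prems by (intro ballot_step) simp
  finally show ?case by simp
qed simp

lemma poly_ineq_ballot:
  fixes u y :: real
  assumes "u \<ge> 0" "2 * y \<ge> 3 * u + 7"
  shows "(u + 1) * ((y + 2 * u) * (y + 2 * u + 1)) + 2 * (u + 1) * y * y < y * ((y + 2 * u) * (y + 2 * u + 1))"
proof -
  define z where "z = 2 * y - (3 * u + 7)"
  have y: "y = (3 * u + 7 + z) / 2" and z: "z \<ge> 0" using assms by (auto simp: z_def)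
  have "8 * (y * ((y + 2 * u) * (y + 2 * u + 1)) - ((u + 1) * ((y + 2 * u) * (y + 2 * u + 1)) + 2 * (u + 1) * y * y))
    = 119 + 87 * z + 17 * z^2 + 1 * z^3 + 259 * u + 118 * u * z + 11 * u * z^2 + 153 * u^2 + 39 * u^2 * z + 13 * u^3"
    unfolding y by (simp add: field_simps power2_eq_square power3_eq_cube)
  also have "\<dots> > 0" using assms z by (intro add_pos_nonneg) auto
  finally show ?thesis by simp
qed

text \<open>For the case of a unique hit: the sum counts the walks exceeding height
  \<open>q = n - 2 * r\<close>, and the ballot term bounds the members that do not.\<close>

lemma sum_choose_ballot_less:
  assumes "0 < r" "7 * r + 2 \<le> 2 * n"
  shows "(\<Sum>i<r. real (n choose i)) + 2 * ballot (n - 2 * r) (r - 1) < real (n choose r)"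
proof -
  obtain s N where s: "r = Suc s" and N: "n = Suc (Suc N)"
    using assms by (cases r; cases n; cases "n - 1") auto
  define S c y K where "S = (\<Sum>i<r. real (n choose i))" and "c = real (N choose s)"
    and "y = real N - 2 * real s + 1" and "K = real (n choose r)"
  have N7: "2 * N \<ge> 7 * s + 5" using assms s N by simp
  have y: "2 * y \<ge> 3 * real s + 7" using of_nat_mono[OF N7, where 'a = real] by (simp add: y_def)
  then have y0: "y > 0" by linarith
  have c: "c > 0" using N7 by (simp add: c_def)
  have "2 * r \<le> n" using assms by simp
  then have Sy: "S * y \<le> K * (real s + 1)" using sum_choose_le[of r n] by (simp add: S_def K_def y_def s N algebra_simps)
  have k1: "(real s + 1) * real (Suc N choose Suc s) = (real N + 1) * c"
  proof -
    have "real (Suc s * (Suc N choose Suc s)) = real (Suc N * (N choose s))"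
      by (simp only: Suc_times_binomial)
    then show ?thesis by (simp add: c_def algebra_simps del: binomial_Suc_Suc)
  qed
  have k2: "(real N - s + 1) * K = (real N + 2) * real (Suc N choose Suc s)"
    using Suc_minus_times_Suc_choose[of "Suc N" "Suc s"] by (simp add: K_def s N algebra_simps del: binomial_Suc_Suc)
  have k3: "(real s + 1) * ((real N - s + 1) * K) = (real N + 2) * ((real N + 1) * c)"
    unfolding k2 k1[symmetric] by simp
  have Ns: "real N - s + 1 > 0" using N7 by linarith
  have B: "ballot (n - 2 * r) (r - 1) = c * y / (real N - s + 1)"
  proof -
    have e: "n - 2 * r + 2 * (r - 1) = N" "real (n - 2 * r) = real N - 2 * real s" "r - 1 = s"
      using N7 s N by auto
    have "ballot (n - 2 * r) (r - 1) = c * (real N - 2 * real s + 1) / (real N - 2 * real s + real s + 1)"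
      unfolding ballot_def e(1) unfolding e(2,3) c_def ..
    then show ?thesis by (simp add: y_def)
  qed
  \<comment> \<open>In the unit \<open>d\<close> both \<open>K\<close> and the ballot number become
    polynomials in \<open>s\<close> and \<open>y\<close>, where \<open>y = n - 2 * r + 1\<close>,
    which reduces the claim to \<open>poly_ineq_ballot\<close>.\<close>
  define d where "d = K / ((real N + 1) * (real N + 2))"
  have d0: "d > 0" using assms by (simp add: d_def K_def)
  have cd: "c / (real N - s + 1) = (real s + 1) * d"
  proof -
    have "c * ((real N + 1) * (real N + 2)) = ((real s + 1) * K) * (real N - s + 1)" using k3 by (simp only: mult_ac)
    moreover have "(real N + 1) * (real N + 2) \<noteq> 0" by simp
    ultimately have "c / (real N - s + 1) = ((real s + 1) * K) / ((real N + 1) * (real N + 2))"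
      using Ns by (subst frac_eq_eq) auto
    then show ?thesis by (simp only: d_def times_divide_eq_right)
  qed
  have B': "ballot (n - 2 * r) (r - 1) = (real s + 1) * d * y"
    unfolding B cd[symmetric] by simp
  have KK: "K = d * ((y + 2 * s) * (y + 2 * s + 1))"
  proof -
    have e: "y + 2 * s = real N + 1" "real N + 1 + 1 = real N + 2" by (simp_all add: y_def)
    have "(real N + 1) * (real N + 2) \<noteq> 0" by simp
    then show ?thesis unfolding e d_def by (metis nonzero_eq_divide_eq)
  qed
  have "(S + 2 * ballot (n - 2 * r) (r - 1)) * y = S * y + 2 * (real s + 1) * d * y * y"
    unfolding B' by (simp add: algebra_simps)
  also have "\<dots> \<le> K * (real s + 1) + 2 * (real s + 1) * d * y * y" using Sy by simp
  also have "\<dots> = d * ((real s + 1) * ((y + 2 * s) * (y + 2 * s + 1)) + 2 * (real s + 1) * y * y)"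
    unfolding KK by (simp add: algebra_simps)
  also have "\<dots> < d * (y * ((y + 2 * s) * (y + 2 * s + 1)))"
    using poly_ineq_ballot[of s y] y d0 by (intro mult_strict_left_mono) auto
  also have "\<dots> = K * y" unfolding KK by simp
  finally have "S + 2 * ballot (n - 2 * r) (r - 1) < K" using y0 by simp
  then show ?thesis by (simp add: S_def K_def)
qed

section \<open>Inequalities for the levels \<open>h > 0\<close>\<close>

lemma poly_ineq_base:
  fixes r n :: real
  assumes "r \<ge> 2" "2 * n \<ge> 7 * r + 2"
  shows "r * (r - 1) * n * (n - 1) < (n - r) * (n - 2 * r - 1) * (n - r + 1) * (n - 2 * r + 3)"
proof -
  define u z where "u = r - 2" and "z = 2 * n - (7 * r + 2)"
  have r: "r = u + 2" and n: "n = (7 * u + 16 + z) / 2" and u: "u \<ge> 0" and z: "z \<ge> 0"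
    using assms by (auto simp: u_def z_def)
  have "16 * ((n - r) * (n - 2 * r - 1) * (n - r + 1) * (n - 2 * r + 3) - r * (r - 1) * n * (n - 1))
    = 12320 + 5304 * z + 764 * z^2 + 46 * z^3 + 1 * z^4 + 16632 * u + 5536 * u * z + 534 * u * z^2 + 16 * u * z^3 + 7604 * u^2 + 1826 * u^2 * z + 90 * u^2 * z^2 + 1242 * u^3 + 184 * u^3 * z + 29 * u^4"
    unfolding n r by (simp add: field_simps power2_eq_square power3_eq_cube power4_eq_xxxx)
  also have "\<dots> > 0" using u z by (intro add_pos_nonneg) auto
  finally show ?thesis by simp
qed

lemma choose_diff_eq:
  assumes "0 < r" "r \<le> N"
  shows "(real N + 1 - r) * (real (N choose r) - real (N choose (r - 1))) = real (N choose r) * (real N + 1 - 2 * r)"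
proof -
  obtain s where s: "r = Suc s" using assms by (cases r) auto
  show ?thesis using Suc_times_choose_Suc[of s N] by (simp add: s algebra_simps)
qed

text \<open>Lowering the upper index by one costs the difference at most a factor
  \<open>5 / 2\<close>; \<open>sum_choose_step\<close> supplies the matching gain.\<close>

lemma choose_diff_step:
  assumes "2 \<le> r" "5 * r + 4 \<le> 2 * Suc M"
  shows "2 * (real (Suc M choose r) - real (Suc M choose (r - 1))) \<le> 5 * (real (M choose r) - real (M choose (r - 1)))"
proof -
  define N where "N = real M + 1"
  define c where "c = real (Suc M choose r)"
  define z where "z = 2 * N - (5 * r + 4)"
  have N: "N = (5 * r + 4 + z) / 2" and z: "z \<ge> 0" using assms(2) by (auto simp: z_def N_def)
  have c0: "c \<ge> 0" by (simp add: c_def)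
  have pos: "N - r > 0" "N + 1 - r > 0" using N z by (auto simp: field_simps)
  have N0: "N > 0" by (simp add: N_def)
  have "4 * (5 * ((N - 2 * r) * (N + 1 - r)) - 2 * (N * (N + 1 - 2 * r)))
     = 72 + 30 * z + 3 * z^2 + 22 * r + 8 * (r * z) + 5 * (real r)^2"
    unfolding N by (simp add: field_simps power2_eq_square)
  also have "\<dots> \<ge> 0" using z by (intro add_nonneg_nonneg) auto
  finally have poly: "2 * (N * (N + 1 - 2 * r)) \<le> 5 * ((N - 2 * r) * (N + 1 - r))" by (simp add: mult.commute)
  have M: "real (M choose r) = (N - r) * c / N"
    using Suc_minus_times_Suc_choose[of M r] N0 by (simp add: c_def N_def field_simps)
  have "(N - r) * (real (M choose r) - real (M choose (r - 1))) = real (M choose r) * (N - 2 * r)"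
    using choose_diff_eq[of r M] assms by (simp add: N_def algebra_simps)
  then have "(N - r) * (real (M choose r) - real (M choose (r - 1))) = (N - r) * (c * (N - 2 * r) / N)"
    unfolding M by simp
  then have b1: "real (M choose r) - real (M choose (r - 1)) = c * (N - 2 * r) / N"
    using pos(1) by (metis less_irrefl mult_left_cancel)
  have b0: "real (Suc M choose r) - real (Suc M choose (r - 1)) = c * (N + 1 - 2 * r) / (N + 1 - r)"
    using choose_diff_eq[of r "Suc M"] assms pos by (simp add: c_def N_def field_simps)
  have "2 * (c * (N + 1 - 2 * r) / (N + 1 - r)) = c * (2 * (N * (N + 1 - 2 * r))) / (N * (N + 1 - r))"
  proof -
    have "2 * (c * X / A) = c * (2 * (N * X)) / (N * A)" for X A using N0 by simp
    then show ?thesis .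
  qed
  also have "\<dots> \<le> c * (5 * ((N - 2 * r) * (N + 1 - r))) / (N * (N + 1 - r))"
    using poly c0 N0 pos by (intro divide_right_mono mult_left_mono) auto
  also have "\<dots> = 5 * (c * (N - 2 * r) / N)"
  proof -
    have "c * (5 * (Y * A)) / (N * A) = 5 * (c * Y / N)" if "A \<noteq> 0" for Y A using that by simp
    then show ?thesis using pos by simp
  qed
  finally show ?thesis unfolding b0 b1 .
qed

text \<open>Each quotient of consecutive binomials in this range is at least \<open>5 / 2\<close>,
  so shifting the index compares the sums termwise.\<close>

lemma sum_choose_step:
  assumes "7 * Suc k \<le> 2 * n"
  shows "5 * (\<Sum>i<k. real (n choose i)) \<le> 2 * (\<Sum>i<Suc k. real (n choose i))"
proof -
  have "5 * real (n choose i) \<le> 2 * real (n choose Suc i)" if "i < k" for i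
  proof -
    have "real (Suc i) * (5 * real (n choose i)) \<le> 2 * (real n - real i) * real (n choose i)"
      using assms that by (simp add: mult.assoc[symmetric] mult_right_mono)
    also have "\<dots> = real (Suc i) * (2 * real (n choose Suc i))"
      using Suc_times_choose_Suc[of i n] by (simp only: mult.assoc mult.left_commute)
    finally show ?thesis by (simp del: of_nat_Suc)
  qed
  then have "5 * (\<Sum>i<k. real (n choose i)) \<le> (\<Sum>i<k. 2 * real (n choose Suc i))"
    unfolding sum_distrib_left by (intro sum_mono) auto
  also have "\<dots> \<le> 2 * (\<Sum>i<Suc k. real (n choose i))"
    by (simp add: sum.lessThan_Suc_shift sum_distrib_left del: sum.lessThan_Suc)
  finally show ?thesis .
qed

text \<open>Induction on \<open>h\<close> from \<open>h = 1\<close>: when \<open>h\<close> grows by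
  one, the left side shrinks at least by the factor \<open>5 / 2\<close> and the right side at most
  by that factor.\<close>

lemma sum_choose_less_diff:
  assumes "7 * r + 2 \<le> 2 * n" "0 < h" "h < r"
  shows "(\<Sum>i<r-h. real (n choose i)) < real (n - h - 1 choose r) - real (n - h - 1 choose (r - 1))"
proof -
  have "Suc g < r \<Longrightarrow> (\<Sum>i<r - Suc g. real (n choose i)) < real (n - Suc g - 1 choose r) - real (n - Suc g - 1 choose (r - 1))" for g
  proof (induction g)
    case 0
    obtain N where N: "n = Suc (Suc N)" using assms by (cases n; cases "n - 1") auto
    \<comment> \<open>For \<open>h = 1\<close> the right side is a difference with upper index
      \<open>N = n - 2\<close>. Both sides are expressed through \<open>K\<close>, and
      \<open>poly_ineq_base\<close> compares the factors.\<close>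
    define S K where "S = (\<Sum>i<r-1. real (n choose i))" and "K = real (n choose r)"
    have r2: "real r \<ge> 2" and nr: "2 * real n \<ge> 7 * real r + 2" using assms by auto
    obtain s where s: "r = Suc s" using 0 by (cases r) auto
    have k1: "real r * K = (real n - r + 1) * real (n choose (r - 1))"
      using Suc_times_choose_Suc[of s n] by (simp add: K_def s)
    have S1: "S * (real n - 2 * r + 3) \<le> real (n choose (r - 1)) * (real r - 1)"
      using sum_choose_le[of s n] assms by (simp add: S_def s algebra_simps)
    have k2: "(real n - r) * ((real n - 1 - r) * K) = (real n - 1) * (real n * real (N choose r)) "
    proof -
      have "(real n - r) * K = real n * real (Suc N choose r)"
        using Suc_minus_times_Suc_choose[of "Suc N" r] by (simp add: K_def N algebra_simps)
      moreover have "(real n - 1 - r) * real (Suc N choose r) = (real n - 1) * real (N choose r)"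
        using Suc_minus_times_Suc_choose[of N r] by (simp add: N algebra_simps)
      ultimately show ?thesis by (metis (no_types, opaque_lifting) mult.assoc mult.commute)
    qed
    have k3: "(real n - 1 - r) * (real (N choose r) - real (N choose (r - 1))) = real (N choose r) * (real n - 1 - 2 * r)"
      using choose_diff_eq[of r N] assms N by (simp add: algebra_simps)
    define D where "D = real (N choose r) - real (N choose (r - 1))"
    have pos: "real n - 1 - r > 0" "real n - r + 1 > 0" "real n - 2 * r + 3 > 0" "real n * (real n - 1) > 0" "real n - r > 0"
      using nr r2 by auto
    have D: "D * (real n * (real n - 1)) = K * (real n - r) * (real n - 2 * r - 1)"
    proof -
      have "(real n - 1 - r) * (D * (real n * (real n - 1))) = ((real n - 1 - r) * D) * (real n * (real n - 1))" by simp
      also have "\<dots> = ((real n - 1) * (real n * real (N choose r))) * (real n - 1 - 2 * r)"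
        using k3 by (simp add: D_def)
      also have "\<dots> = (real n - 1 - r) * (K * (real n - r) * (real n - 2 * r - 1))"
        unfolding k2[symmetric] by (simp add: algebra_simps)
      finally show ?thesis using pos by simp
    qed
    have K0: "K > 0" using assms by (simp add: K_def)
    let ?w = "(real n - r + 1) * (real n - 2 * r + 3)"
    have "S * ?w * (real n * (real n - 1)) = (S * (real n - 2 * r + 3)) * (real n - r + 1) * (real n * (real n - 1))"
      by (simp add: mult_ac)
    also have "\<dots> \<le> (real (n choose (r - 1)) * (real r - 1)) * (real n - r + 1) * (real n * (real n - 1))"
      using S1 pos by (intro mult_right_mono) auto
    also have "\<dots> = ((real n - r + 1) * real (n choose (r - 1))) * (real r - 1) * (real n * (real n - 1))"
      by (simp add: mult_ac)
    also have "\<dots> = K * (real r * (real r - 1) * real n * (real n - 1))"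
      unfolding k1[symmetric] by (simp add: mult_ac)
    also have "\<dots> < K * ((real n - r) * (real n - 2 * r - 1) * (real n - r + 1) * (real n - 2 * r + 3))"
      using poly_ineq_base[OF r2 nr] K0 by (intro mult_strict_left_mono) auto
    also have "\<dots> = (K * (real n - r) * (real n - 2 * r - 1)) * ?w" by (simp add: mult_ac)
    also have "\<dots> = D * ?w * (real n * (real n - 1))" unfolding D[symmetric] by (simp add: mult_ac)
    finally have "S * (?w * (real n * (real n - 1))) < D * (?w * (real n * (real n - 1)))" by (simp only: mult.assoc)
    then have "S < D" by (rule mult_right_less_imp_less) (use pos in auto)
    then show ?case by (simp add: S_def D_def N)
  next
    case (Suc g)
    define M where "M = n - Suc (Suc g) - 1"
    have M: "n - Suc g - 1 = Suc M" using assms Suc.prems by (auto simp: M_def)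
    have rg: "r - Suc g = Suc (r - Suc (Suc g))" using Suc.prems by simp
    have "5 * (\<Sum>i<r - Suc (Suc g). real (n choose i)) \<le> 2 * (\<Sum>i<r - Suc g. real (n choose i))"
      unfolding rg using assms by (intro sum_choose_step) auto
    also have "\<dots> < 2 * (real (Suc M choose r) - real (Suc M choose (r - 1)))"
      using Suc.IH Suc.prems M by simp
    \<comment> \<open>From \<open>Suc (Suc g) < r\<close> and \<open>7 * r + 2 \<le> 2 * n\<close>
      follows exactly the required \<open>5 * r + 4 \<le> 2 * Suc M\<close>.\<close>
    also have "\<dots> \<le> 5 * (real (M choose r) - real (M choose (r - 1)))"
      using assms Suc.prems by (intro choose_diff_step) (auto simp: M_def)
    finally show ?case by (simp add: M_def)
  qed
  from this[of "h - 1"] show ?thesis using assms by simp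
qed

section \<open>Shifted families\<close>

text \<open>If the walk of \<open>G\<close> never exceeds height \<open>q + h\<close> and ends below \<open>q\<close>, then a walk that stays
  below \<open>q - h\<close> until it makes \<open>h + 1\<close> final up steps to \<open>q\<close> cannot lie in the family together
  with \<open>G\<close>.\<close>

lemma card_missing:
  assumes fam: "\<H> \<subseteq> Pow {1..n}" "intersecting q \<H>" "left_shifted \<H>"
    and n: "n = q + 2 * r" and G: "G \<in> \<H>" "card G < q + r" "hits n (Suc (q + h)) G = {}"
    and h: "h < q" "h < r"
  shows "card {A \<in> \<H>. card A = q + r} + ((n - h - 1) choose r) \<le> (n choose r) + ((n - h - 1) choose (r - 1))"
proof -
  \<comment> \<open>After \<open>N\<close> steps a walk with \<open>k\<close> up steps is at height
    \<open>q - h - 1\<close>, just below the barrier, and \<open>h + 1\<close> up steps then take it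
    to \<open>q\<close>.\<close>
  define N k where "N = n - h - 1" and "k = q - h + (r - 1)"
  define W where "W = walks N k (q - h) (\<lambda>T. T = {})"
  define f where "f B = B \<union> {N<..n}" for B
  have Nn: "N \<le> n" "n - N = h + 1" using n h by (auto simp: N_def)
  have kN: "k + r = N" "k + (h + 1) = q + r" using n h by (auto simp: N_def k_def)
  have finG: "finite G" using G fam finite_subset by blast
  have "card W + (N choose (r - 1)) = N choose k"
    unfolding W_def k_def by (rule card_nonreaching) (use n h in \<open>auto simp: N_def\<close>)
  also have "\<dots> = N choose r" 
  proof -
    have "r \<le> N" "N - r = k" using kN by auto
    then show ?thesis using binomial_symmetric[of r N] by simp
  qed
  finally have cW: "card W + (N choose (r - 1)) = N choose r" .
  have Wsub: "B \<subseteq> {1..N}" "card B = k" "hits N (q - h) B = {}" "finite B" if "B \<in> W" for B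
    using that finite_subset[of B "{1..N}"] by (auto simp: W_def walks_def)
  have "inj_on f W"
  proof (rule inj_onI)
    fix A B assume AB: "A \<in> W" "B \<in> W" "f A = f B"
    have "C = f C \<inter> {1..N}" if "C \<in> W" for C using Wsub(1)[OF that] by (auto simp: f_def)
    then show "A = B" using AB by metis
  qed
  then have cf: "card (f ` W) = card W" by (rule card_image)
  have cfB: "card (f B \<inter> {1..t}) = k + (t - N)" if "B \<in> W" "N \<le> t" "t \<le> n" for B t
  proof -
    have "f B \<inter> {1..t} = B \<union> {N<..t}" using Wsub[OF that(1)] that by (fastforce simp: f_def)
    moreover have "B \<inter> {N<..t} = {}" using Wsub[OF that(1)] by fastforce
    ultimately show ?thesis using Wsub[OF that(1)] by (simp add: card_Un_disjoint)
  qed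
  have fk: "f B \<subseteq> {1..n} \<and> card (f B) = q + r" if "B \<in> W" for B
  proof -
    have "f B \<subseteq> {1..n}" using Wsub[OF that] Nn by (fastforce simp: f_def)
    then have "f B \<inter> {1..n} = f B" by auto
    then show ?thesis using cfB[OF that, of n] Nn kN \<open>f B \<subseteq> {1..n}\<close> by simp
  qed
  have notin: "f B \<notin> \<H>" if B: "B \<in> W" for B
  proof
    assume "f B \<in> \<H>"
    from left_shifted_prefix[OF fam this G(1)] obtain t where
      t: "t \<le> n" "t + q \<le> card (f B \<inter> {1..t}) + card (G \<inter> {1..t})" by blast
    show False
    proof (cases "t \<le> N")
      case True
      then have "f B \<inter> {1..t} = B \<inter> {1..t}" by (auto simp: f_def)
      \<comment> \<open>The heights are at most \<open>q - h - 1\<close> and \<open>q + h\<close>,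
        with sum below \<open>2 * q\<close>.\<close>
      moreover have "t \<notin> hits N (q - h) B" "t \<notin> hits n (Suc (q + h)) G" using Wsub[OF B] G by auto
      ultimately show False using t True h by (auto simp: hits_def)
    next
      case False
      \<comment> \<open>During the final up steps \<open>f B\<close> has exactly
        \<open>t - r\<close> elements up to \<open>t\<close>, since \<open>N = k + r\<close>, while
        \<open>G\<close> has fewer than \<open>q + r\<close> in all.\<close>
      have "card (G \<inter> {1..t}) \<le> card G" using finG by (intro card_mono) auto
      then show False using cfB[OF B, of t] t False G kN by simp
    qed
  qed
  let ?E = "{A \<in> \<H>. card A = q + r}"
  have fin: "finite ?E" "finite (f ` W)" using fam finite_subset[of \<H> "Pow {1..n}"] by (auto simp: W_def)
  have "card ?E + card (f ` W) = card (?E \<union> f ` W)"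
    using notin fin by (intro card_Un_disjoint[symmetric]) auto
  also have "\<dots> \<le> card {A. A \<subseteq> {1..n} \<and> card A = q + r}"
    using fk fam by (intro card_mono finite_subsets) auto
  also have "\<dots> = n choose r" using n card_subsets[of n "q + r"] binomial_symmetric[of r n] by (simp add: add.commute)
  finally show ?thesis using cW cf by (simp add: N_def)
qed

text \<open>Reflection in height \<open>q + 1\<close> gives the difference in
  \<open>ballot_Suc\<close>; \<open>R = 0\<close> is separate because that formula needs a
  predecessor.\<close>

lemma card_ballot_walks: "real (card (walks (q + 2 * R) (q + R) (Suc q) (\<lambda>T. T = {}))) \<le> ballot q R"
proof (cases R)
  case 0
  have "card (walks q q (Suc q) (\<lambda>T. T = {})) \<le> card {A. A \<subseteq> {1..q} \<and> card A = q}"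
    by (intro card_mono finite_subsets) (auto simp: walks_def)
  then show ?thesis using 0 card_subsets[of q q] by (simp add: ballot_0)
next
  case (Suc R')
  have "card (walks (q + 2 * R) (Suc q + R') (Suc q) (\<lambda>T. T = {})) + (q + 2 * R choose R') = q + 2 * R choose (Suc q + R')"
    by (rule card_nonreaching) (auto simp: Suc)
  moreover have "q + 2 * R choose (Suc q + R') = q + 2 * R choose Suc R'"
  proof -
    have "Suc R' \<le> q + 2 * R" "q + 2 * R - Suc R' = Suc q + R'" by (auto simp: Suc)
    then show ?thesis using binomial_symmetric[of "Suc R'" "q + 2 * R"] by metis
  qed
  ultimately have "real (card (walks (q + 2 * R) (Suc q + R') (Suc q) (\<lambda>T. T = {})))
      = real (q + 2 * R choose Suc R') - real (q + 2 * R choose R')" by simp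
  then show ?thesis using ballot_Suc[of q R'] by (simp add: Suc del: binomial_Suc_Suc)
qed

text \<open>Every walk in the family that stays at height at most \<open>q\<close> must be at height \<open>q\<close> at the time
  \<open>\<tau>\<close>, and hence steps down right after it. This leaves a ballot walk up to \<open>\<tau>\<close> and an arbitrary set
  after \<open>\<tau> + 1\<close>.\<close>

lemma card_unique_hit:
  assumes fam: "\<H> \<subseteq> Pow {1..n}" "intersecting q \<H>" "left_shifted \<H>"
    and n: "n = q + 2 * r" "3 * r + 2 \<le> 2 * q" "0 < q"
    and G: "G \<in> \<H>" "card G < q + r" "hits n q G = {\<tau>}"
  shows "real (card {A \<in> \<H>. hits n (Suc q) A = {}}) \<le> 2 * ballot q (r - 1)"
proof -
  let ?M = "{A \<in> \<H>. hits n (Suc q) A = {}}"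
  define g where "g = card (G \<inter> {1..\<tau>})"
  have finG: "finite G" using G fam finite_subset by blast
  have "\<tau> \<in> hits n q G" using G by simp
  then have tau: "\<tau> \<le> n" "\<tau> + q \<le> 2 * g" by (auto simp: hits_def g_def)
  \<comment> \<open>Exceeding \<open>q\<close> at \<open>\<tau>\<close> would give a hit at
    \<open>\<tau> - 1\<close>, so the height at \<open>\<tau>\<close> is exactly
    \<open>q\<close>.\<close>
  have "\<tau> \<notin> hits n (Suc q) G" using hits_Suc_level[of \<tau> n q G] G by auto
  then have geq: "2 * g = \<tau> + q" using tau by (auto simp: hits_def g_def)
  have "g \<le> card {1..\<tau>}" unfolding g_def by (intro card_mono) auto
  then have gq: "q \<le> g" using geq by simp
  have "g \<le> card G" unfolding g_def using finG by (intro card_mono) auto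
  then have gr: "g < q + r" using G by simp
  define R j where "R = g - q" and "j = r - Suc R"
  have Rj: "R + j = r - 1" "\<tau> = q + 2 * R" "g = q + R" "\<tau> + 2 * Suc j = n" "Suc \<tau> \<le> n"
    using geq gq gr n by (auto simp: R_def j_def)
  let ?W = "walks \<tau> (q + R) (Suc q) (\<lambda>T. T = {})"
  define f where "f A = (A \<inter> {1..\<tau>}, A \<inter> {Suc (Suc \<tau>)..n})" for A :: "nat set"
  have M: "card (A \<inter> {1..\<tau>}) = g \<and> Suc \<tau> \<notin> A" if A: "A \<in> ?M" for A
  proof -
    have le: "2 * card (A \<inter> {1..t}) \<le> t + q" if "t \<le> n" for t
    proof -
      have "t \<notin> hits n (Suc q) A" using A by simp
      then show ?thesis using that by (simp add: hits_def)
    qed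
    obtain t where t: "t \<le> n" "t + q \<le> card (A \<inter> {1..t}) + card (G \<inter> {1..t})"
      using left_shifted_prefix[OF fam _ G(1), of A] A by blast
    \<comment> \<open>The heights sum to at least \<open>2 * q\<close> and that of \<open>A\<close>
      is at most \<open>q\<close>, so \<open>G\<close> has height at least \<open>q\<close>;
      uniqueness gives \<open>t = \<tau>\<close>, and then \<open>A\<close> is at \<open>q\<close>
      too.\<close>
    then have "t \<in> hits n q G" using le[of t] by (auto simp: hits_def)
    then have "t = \<tau>" using G by simp
    then have a: "card (A \<inter> {1..\<tau>}) = g" using t le[of \<tau>] geq by (simp add: g_def)
    have "Suc \<tau> \<notin> A"
    proof
      assume "Suc \<tau> \<in> A"
      then have "A \<inter> {1..Suc \<tau>} = insert (Suc \<tau>) (A \<inter> {1..\<tau>})" by (auto simp: le_Suc_eq)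
      then show False using a le[OF Rj(5)] geq by simp
    qed
    then show ?thesis using a by simp
  qed
  have "inj_on f ?M"
  proof (rule inj_onI)
    fix A B assume AB: "A \<in> ?M" "B \<in> ?M" "f A = f B"
    have "C = fst (f C) \<union> snd (f C)" if "C \<in> ?M" for C
    proof -
      have "C \<subseteq> {1..n}" "Suc \<tau> \<notin> C" using M[OF that] that fam by auto
      then show ?thesis by (fastforce simp: f_def not_le less_Suc_eq_le le_Suc_eq)
    qed
    then show "A = B" using AB by metis
  qed
  moreover have "f ` ?M \<subseteq> ?W \<times> Pow {Suc (Suc \<tau>)..n}"
  proof
    fix x assume "x \<in> f ` ?M"
    then obtain A where A: "A \<in> ?M" "x = f A" by blast
    have "A \<inter> {1..\<tau>} \<inter> {1..t} = A \<inter> {1..t}" if "t \<le> \<tau>" for t using that by auto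
    then have "hits \<tau> (Suc q) (A \<inter> {1..\<tau>}) \<subseteq> hits n (Suc q) A" using tau by (auto simp: hits_def)
    then have "A \<inter> {1..\<tau>} \<in> ?W" using A M[of A] Rj by (auto simp: walks_def)
    then show "x \<in> ?W \<times> Pow {Suc (Suc \<tau>)..n}" using A by (auto simp: f_def)
  qed
  ultimately have "card ?M \<le> card (?W \<times> Pow {Suc (Suc \<tau>)..n})"
    by (intro card_inj_on_le) auto
  also have "\<dots> = card ?W * (2 * 4 ^ j)"
  proof -
    have "card {Suc (Suc \<tau>)..n} = Suc (2 * j)" using Rj by simp
    then show ?thesis by (simp add: card_cartesian_product card_Pow power_mult)
  qed
  finally have "real (card ?M) \<le> real (card ?W) * (2 * 4 ^ j)"
    using of_nat_mono[where 'a = real] by fastforce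
  also have "\<dots> \<le> ballot q R * (2 * 4 ^ j)"
    using card_ballot_walks[of q R] Rj by (intro mult_right_mono) auto
  also have "\<dots> = 2 * (4 ^ j * ballot q R)" by simp
  \<comment> \<open>The bound is weakest when only one free step remains.\<close>
  also have "\<dots> \<le> 2 * ballot q (R + j)"
    using n Rj(1) gr gq by (intro mult_left_mono ballot_power) (auto simp: R_def j_def)
  finally show ?thesis using Rj by simp
qed

lemma card_left_shifted_less:
  assumes fam: "\<H> \<subseteq> Pow {1..n}" "intersecting q \<H>" "left_shifted \<H>"
    and n: "n = q + 2 * r" "7 * r + 2 \<le> 2 * n" "0 < r"
    and small: "{A \<in> \<H>. card A < q + r} \<noteq> {}"
  shows "card {A \<in> \<H>. card A \<le> q + r} < n choose r"
proof -
  define S E where "S = {A \<in> \<H>. card A < q + r}" and "E = {A \<in> \<H>. card A = q + r}"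
  have finH: "finite \<H>" using fam finite_subset by blast
  have q: "3 * r + 2 \<le> 2 * q" "0 < q" "r \<le> q" using n by auto
  have fin: "finite A" if "A \<in> \<H>" for A using fam that finite_subset by blast
  have hit: "hits n q A \<noteq> {}" if A: "A \<in> \<H>" for A
  proof -
    obtain t where "t \<le> n" "t + q \<le> card (A \<inter> {1..t}) + card (A \<inter> {1..t})"
      using left_shifted_prefix[OF fam A A] by blast
    then have "t \<in> hits n q A" by (simp add: hits_def)
    then show ?thesis by blast
  qed
  have hit_card: "m \<le> card A" if "A \<in> \<H>" "hits n m A \<noteq> {}" for A m
    using hits_card fin that by blast
  have "{A \<in> \<H>. card A \<le> q + r} = S \<union> E" by (auto simp: S_def E_def)
  moreover have "S \<inter> E = {}" by (auto simp: S_def E_def)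
  ultimately have total: "card {A \<in> \<H>. card A \<le> q + r} = card S + card E"
    using finH by (simp add: card_Un_disjoint S_def E_def)
  consider (unique) G \<tau> where "G \<in> S" "hits n q G = {\<tau>}"
    | (twice) G where "G \<in> S" "hits n (Suc q) G = {}" "\<forall>A\<in>S. 2 \<le> card (hits n q A)"
    | (high) "\<forall>A\<in>S. hits n (Suc q) A \<noteq> {}"
  proof (cases "\<exists>G\<in>S. card (hits n q G) = 1")
    case True
    then show thesis using unique by (metis card_1_singletonE)
  next
    case False
    have "2 \<le> card (hits n q A)" if "A \<in> S" for A
    proof -
      have "card (hits n q A) \<noteq> 0" using hit that by (simp add: S_def)
      moreover have "card (hits n q A) \<noteq> 1" using False that by blast
      ultimately show ?thesis by linarith
    qed
    then show thesis using twice high by blast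
  qed
  then show ?thesis
  proof cases
    case unique
    have G: "G \<in> \<H>" "card G < q + r" using unique by (auto simp: S_def)
    let ?X = "{A. A \<subseteq> {1..n} \<and> Suc q \<le> card A \<and> card A < Suc q + r \<and> hits n (Suc q) A \<noteq> {}}"
    let ?Y = "{A \<in> \<H>. hits n (Suc q) A = {}}"
    \<comment> \<open>Exceeding \<open>q\<close> takes at least \<open>q + 1\<close> elements, so
      reflection in height \<open>q + 1\<close> over the sizes \<open>Suc q + j\<close> with
      \<open>j < r\<close> bounds \<open>?X\<close>, which is not restricted to members.\<close>
    have "{A \<in> \<H>. card A \<le> q + r} \<subseteq> ?X \<union> ?Y" using fam hit_card by fastforce
    then have "card {A \<in> \<H>. card A \<le> q + r} \<le> card (?X \<union> ?Y)"
      using finH by (intro card_mono) auto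
    also have "\<dots> \<le> card ?X + card ?Y" by (rule card_Un_le)
    also have "card ?X \<le> (\<Sum>j<r. n choose j)"
      by (rule card_small_walks[where P = "\<lambda>T. T \<noteq> {}"], rule eq_refl, rule card_walks_reaching)
        (use n in auto)
    finally have "real (card {A \<in> \<H>. card A \<le> q + r}) \<le> (\<Sum>j<r. real (n choose j)) + real (card ?Y)"
      by (simp flip: of_nat_sum of_nat_add)
    also have "\<dots> \<le> (\<Sum>j<r. real (n choose j)) + 2 * ballot q (r - 1)"
      using card_unique_hit[OF fam n(1) q(1,2) G unique(2)] by simp
    also have "\<dots> < real (n choose r)"
      using sum_choose_ballot_less[OF n(3,2)] n(1) by simp
    finally show ?thesis by simp
  next
    case twice
    have G: "G \<in> \<H>" "card G < q + r" using twice by (auto simp: S_def)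
    \<comment> \<open>This is the level \<open>h = 0\<close>, as \<open>G\<close> does not exceed
      \<open>q\<close>.\<close>
    have E: "card E + ((n - 1) choose r) \<le> (n choose r) + ((n - 1) choose (r - 1))"
      using card_missing[OF fam n(1) G, of 0] twice q n by (simp add: E_def)
    have "S \<subseteq> {A. A \<subseteq> {1..n} \<and> q \<le> card A \<and> card A < q + r \<and> 2 \<le> card (hits n q A)}"
      using fam hit hit_card twice by (auto simp: S_def)
    then have "card S \<le> card {A. A \<subseteq> {1..n} \<and> q \<le> card A \<and> card A < q + r \<and> 2 \<le> card (hits n q A)}"
      by (intro card_mono finite_subsets)
    also have "\<dots> \<le> (\<Sum>j<r. if j = 0 then 0 else 2 * ((n - 1) choose (j - 1)))"
      by (rule card_small_walks[where P = "\<lambda>T. 2 \<le> card T"], rule card_walks_twice) (use n q in auto)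
    also have "\<dots> = 2 * (\<Sum>i<r-1. (n - 1) choose i)"
      using n(3) by (cases r) (simp_all add: sum.lessThan_Suc_shift sum_distrib_left del: sum.lessThan_Suc)
    finally show ?thesis using E twice_sum_choose_less[OF n(3,2)] total by linarith
  next
    case high
    \<comment> \<open>The lowest level above \<open>q\<close> that some smaller member misses; the
      \<open>h\<close> of the argument is \<open>k - 1\<close>. A set with fewer than
      \<open>q + r\<close> elements cannot reach \<open>q + r\<close>, so \<open>k\<close> exists
      and \<open>h < r\<close>.\<close>
    define k where "k = (LEAST k. \<exists>G\<in>S. hits n (q + k) G = {})"
    obtain G0 where "G0 \<in> S" using small by (auto simp: S_def)
    moreover have "hits n (q + r) G0 = {}"
      using hit_card[of G0 "q + r"] \<open>G0 \<in> S\<close> by (force simp: S_def)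
    ultimately have ex: "\<exists>G\<in>S. hits n (q + r) G = {}" by blast
    have kr: "k \<le> r" unfolding k_def using ex by (rule Least_le)
    obtain G where G: "G \<in> S" "hits n (q + k) G = {}"
      using LeastI[of "\<lambda>k. \<exists>G\<in>S. hits n (q + k) G = {}", OF ex] unfolding k_def by blast
    have "k \<noteq> 0" using G hit[of G] by (auto simp: S_def intro!: gr0I)
    moreover have "k \<noteq> 1" using G high by auto
    ultimately obtain h where h: "k = Suc h" "0 < h" by (cases k) auto
    have hS: "hits n (q + h) A \<noteq> {}" if "A \<in> S" for A
      using not_less_Least[of h "\<lambda>k. \<exists>G\<in>S. hits n (q + k) G = {}"] h that unfolding k_def[symmetric] by auto
    have E: "card E + ((n - h - 1) choose r) \<le> (n choose r) + ((n - h - 1) choose (r - 1))"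
      unfolding E_def by (rule card_missing[OF fam n(1)]) (use G h kr q in \<open>auto simp: S_def\<close>)
    have "S \<subseteq> {A. A \<subseteq> {1..n} \<and> q + h \<le> card A \<and> card A < (q + h) + (r - h) \<and> hits n (q + h) A \<noteq> {}}"
    proof
      fix A assume "A \<in> S"
      then have "A \<in> \<H>" "card A < q + r" by (auto simp: S_def)
      then show "A \<in> {A. A \<subseteq> {1..n} \<and> q + h \<le> card A \<and> card A < (q + h) + (r - h) \<and> hits n (q + h) A \<noteq> {}}"
        using hS[OF \<open>A \<in> S\<close>] hit_card[of A "q + h"] fam kr h by auto
    qed
    then have "card S \<le> card {A. A \<subseteq> {1..n} \<and> q + h \<le> card A \<and> card A < (q + h) + (r - h) \<and> hits n (q + h) A \<noteq> {}}"
      by (intro card_mono finite_subsets)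
    also have "\<dots> \<le> (\<Sum>j<r-h. n choose j)"
      by (rule card_small_walks[where P = "\<lambda>T. T \<noteq> {}"], rule eq_refl, rule card_walks_reaching)
        (use n q in auto)
    finally have "real (card S) \<le> (\<Sum>j<r-h. real (n choose j))" by (simp flip: of_nat_sum)
    also have "\<dots> < real ((n - h - 1) choose r) - real ((n - h - 1) choose (r - 1))"
      using n h kr by (intro sum_choose_less_diff) auto
    finally have "real (card S + ((n - h - 1) choose (r - 1))) < real ((n - h - 1) choose r)" by simp
    then have "card S + ((n - h - 1) choose (r - 1)) < (n - h - 1) choose r" by (simp only: of_nat_less_iff)
    then show ?thesis using E total by linarith
  qed
qed

section \<open>Passage to complements and the theorem\<close>

text \<open>Complements of two members meet in \<open>n - card (A \<union> B) \<ge> q\<close>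
  elements. Size at least \<open>r\<close> becomes size at most \<open>q + r\<close>, and
  \<open>F\<close> becomes a member of size below \<open>q + r\<close>.\<close>

lemma card_union_family_less:
  assumes "0 < r" "7 * r + 2 \<le> 2 * n" "\<F> \<subseteq> Pow {1..n}" "union_family (2 * r) \<F>"
    and big: "F \<in> \<F>" "r < card F"
  shows "card (size_at_least r \<F>) < n choose r"
proof -
  define q where "q = n - 2 * r"
  have n: "n = q + 2 * r" using assms(2) by (simp add: q_def)
  define c where "c A = {1..n} - A" for A
  define \<H> where "\<H> = c ` size_at_least r \<F>"
  have cc: "c (c A) = A" "card (c A) + card A = n" if "A \<in> \<F>" for A
  proof -
    have A: "A \<subseteq> {1..n}" using that assms by auto
    then show "c (c A) = A" by (auto simp: c_def)
    show "card (c A) + card A = n"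
      using A card_mono[of "{1..n}" A] by (simp add: c_def card_Diff_subset finite_subset)
  qed
  have sub: "size_at_least r \<F> \<subseteq> \<F>" by (auto simp: size_at_least_def)
  have HP: "\<H> \<subseteq> Pow {1..n}" by (auto simp: \<H>_def c_def)
  then have finH: "finite \<H>" using finite_subset by blast
  have "intersecting q \<H>"
    unfolding intersecting_def
  proof (intro ballI)
    fix X Y assume "X \<in> \<H>" "Y \<in> \<H>"
    then obtain A B where AB: "A \<in> \<F>" "B \<in> \<F>" "X = c A" "Y = c B" using sub by (auto simp: \<H>_def)
    have "card (A \<union> B) \<le> 2 * r" using assms AB by (auto simp: union_family_def)
    moreover have "A \<union> B \<subseteq> {1..n}" using AB assms by auto
    moreover from this have "card ({1..n} - (A \<union> B)) = n - card (A \<union> B)"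
      using card_Diff_subset[of "A \<union> B" "{1..n}"] finite_subset[of "A \<union> B" "{1..n}"] by simp
    moreover have "X \<inter> Y = {1..n} - (A \<union> B)" using AB by (auto simp: c_def)
    ultimately show "q \<le> card (X \<inter> Y)" using n by simp
  qed
  from exists_left_shifted[OF HP this] obtain \<G> where
    G: "\<G> \<subseteq> Pow {1..n}" "intersecting q \<G>" "left_shifted \<G>"
    and cG: "\<And>P. card {A \<in> \<G>. P (card A)} = card {A \<in> \<H>. P (card A)}" by blast
  have "inj_on c (size_at_least r \<F>)" using cc sub by (metis inj_onI subsetD)
  then have "card (size_at_least r \<F>) = card \<H>" by (simp add: \<H>_def card_image)
  also have "\<H> = {A \<in> \<H>. card A \<le> q + r}"
  proof -
    have "card (c A) \<le> q + r" if "A \<in> size_at_least r \<F>" for A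
      using cc(2)[of A] that n by (auto simp: size_at_least_def)
    then show ?thesis by (auto simp: \<H>_def)
  qed
  also have "card \<dots> = card {A \<in> \<G>. card A \<le> q + r}" by (rule cG[symmetric])
  also have "\<dots> < n choose r"
  proof (rule card_left_shifted_less[OF G n assms(2,1)])
    have "c F \<in> {A \<in> \<H>. card A < q + r}"
      using big cc(2)[of F] n by (auto simp: \<H>_def size_at_least_def)
    \<comment> \<open>Shifting may move the small set itself; what survives is the number of sets
      below this size.\<close>
    then have "card {A \<in> \<H>. card A < q + r} \<noteq> 0" using finH by auto
    then have "card {A \<in> \<G>. card A < q + r} \<noteq> 0" unfolding cG[of "\<lambda>k. k < q + r"] .
    then show "{A \<in> \<G>. card A < q + r} \<noteq> {}" by (metis card.empty)
  qed
  finally show ?thesis .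
qed

theorem theorem1p9:
  fixes n r :: nat and \<F> :: "nat set set"
  assumes "n > 0" and "r > 0"
    and "real n \<ge> 3.5 * real r + 1"
    and "\<F> \<subseteq> Pow {1..n}"
    and "union_family (2 * r) \<F>"
  shows "card (size_at_least r \<F>) \<le> n choose r
    \<and> (card (size_at_least r \<F>) = n choose r
        \<longleftrightarrow> size_at_least r \<F> = k_subsets {1..n} r)"
proof -
  have "real (7 * r + 2) \<le> real (2 * n)" using assms(3) by simp
  then have n: "7 * r + 2 \<le> 2 * n" by (simp only: of_nat_le_iff)
  have ck: "card (k_subsets {1..n} r) = n choose r" "finite (k_subsets {1..n} r)"
    using card_subsets[of n r] by (simp_all add: k_subsets_def)
  show ?thesis
  proof (cases "\<exists>F\<in>\<F>. r < card F")
    case True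
    then have "card (size_at_least r \<F>) < n choose r"
      using card_union_family_less[OF assms(2) n assms(4,5)] by blast
    then show ?thesis using ck by auto
  next
    case False
    \<comment> \<open>Without members larger than \<open>r\<close>, only sets of size
      \<open>r\<close> are counted, and equality of finite cardinalities forces equality of the
      families.\<close>
    then have "size_at_least r \<F> \<subseteq> k_subsets {1..n} r"
      using assms(4) by (fastforce simp: size_at_least_def k_subsets_def)
    then show ?thesis using ck card_mono[OF ck(2)] card_subset_eq[OF ck(2)] by metis
  qed
qed

end
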